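(* Let $n\ge 2$ and $D\ge 1$ be integers, let $a$ and $b$ be positive integers, and let $X\subset[n]^D$ be a set of size at least $a\left(1+\frac{3n}{D}\right)N_{n,D}+b$. Then $X$ contains at least $\frac{b}{a!\,n^a}D^a$ comparable pairs.
   Context: Here $[n]=\{0,1,\ldots,n-1\}$, and $[n]^D$ is partially ordered coordinatewise: $x\preccurlyeq y$ iff $x_i\le y_i$ for all $1\le i\le D$; $x\prec y$ means $x\preccurlyeq y$ and $x\ne y$. A comparable pair in $X$ is a pair $(x,y)$ with $x,y\in X$ and $x\prec y$. $N_{n,D}$ denotes the size of the middle layer of $[n]^D$, i.e. the number of sequences $(a_1,\ldots,a_D)$ with $a_i\in[n]$ and $\sum_{i=1}^D a_i=\lfloor\frac{n-1}{2}D\rfloor$; this equals the size of a largest antichain in $[n]^D$. *)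

theory Defs
  imports Complex_Main "HOL-Library.FuncSet"
begin

text \<open>
  Points of \<open>[n]\<^sup>D\<close> are functions on the index set \<open>{1..D}\<close>, made extensional by \<open>\<Pi>\<^sub>E\<close>
  so that equality of points is equality of all \<open>D\<close> coordinates and cardinalities are
  the intended ones.
\<close>

definition grid :: "nat \<Rightarrow> nat \<Rightarrow> (nat \<Rightarrow> nat) set" where
  "grid n D = {1..D} \<rightarrow>\<^sub>E {0..<n}"

definition grid_le :: "nat \<Rightarrow> (nat \<Rightarrow> nat) \<Rightarrow> (nat \<Rightarrow> nat) \<Rightarrow> bool" where
  "grid_le D x y \<longleftrightarrow> (\<forall>i\<in>{1..D}. x i \<le> y i)"

definition grid_less :: "nat \<Rightarrow> (nat \<Rightarrow> nat) \<Rightarrow> (nat \<Rightarrow> nat) \<Rightarrow> bool" where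
  "grid_less D x y \<longleftrightarrow> grid_le D x y \<and> x \<noteq> y"

definition comparable_pairs :: "nat \<Rightarrow> (nat \<Rightarrow> nat) set \<Rightarrow> ((nat \<Rightarrow> nat) \<times> (nat \<Rightarrow> nat)) set" where
  "comparable_pairs D X = {(x, y). x \<in> X \<and> y \<in> X \<and> grid_less D x y}"

definition middle_layer :: "nat \<Rightarrow> nat \<Rightarrow> (nat \<Rightarrow> nat) set" where
  "middle_layer n D =
     {x \<in> grid n D. int (\<Sum>i\<in>{1..D}. x i) = \<lfloor>(real n - 1) / 2 * real D\<rfloor>}"

definition middle_layer_size :: "nat \<Rightarrow> nat \<Rightarrow> nat" where
  "middle_layer_size n D = card (middle_layer n D)"

end

theory Submission
  imports Defs "HOL-Combinatorics.Permutations"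
begin

text \<open>
  Write \<open>N\<close> for the size of the middle layer. If \<open>[n]\<^sup>D\<close> is covered by \<open>N\<close> chains that meet
  consecutive layers, a chain with \<open>m\<close> points of \<open>X\<close> contains at least \<open>m - a\<close> pairs of points of
  \<open>X\<close> whose ranks differ by \<open>a\<close> or more: pair each point, except the lowest \<open>a\<close>, with the lowest
  one. So every chain cover by \<open>N\<close> chains yields \<open>|X| - aN\<close> comparable pairs. To obtain many
  more pairs one averages over chain covers in which any particular pair at distance at least \<open>a\<close>
  rarely lies on a common chain; if that happens with frequency at most \<open>a! (n/D)\<^sup>a\<close>, there
  are at least \<open>(|X| - aN) D\<^sup>a / (a! n\<^sup>a)\<close> pairs, and \<open>|X| - aN \<ge> b\<close>.

  The average over chain covers is encoded as a fractional one: weights \<open>f x y\<close> between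
  consecutive layers with all in- and out-sums at most \<open>1\<close>, read as transition probabilities of a
  walk that climbs the layers. Its number of chains is the total deficit of the in-sums, and the
  counting argument above becomes \<open>card_minus_sources_le_path_weights\<close>. If \<open>f \<le> n/D\<close>, the
  bound \<open>a! (n/D)\<^sup>a\<close> holds because at most \<open>a!\<close> saturated paths join two points at
  distance \<open>a\<close>. It remains to find weights bounded by \<open>n/D\<close> with only \<open>N\<close> chains.

  For this, a point \<open>x\<close> is read as a word of parentheses in which coordinate \<open>i\<close> contributes
  \<open>x\<^sub>i\<close> closing ones and then \<open>n - 1 - x\<^sub>i\<close> opening ones. As in the bracketing construction of symmetric
  chain decompositions, \<open>x\<close> is matched to the point where the first unmatched opening
  parenthesis is turned into a closing one. In terms of the walk traced by the word, the coordinate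
  to raise is the one where the walk has its last minimum (\<open>last_min\<close>); after raising, it is the
  one with the first minimum, so the map is injective (\<open>raises_injective\<close>), and below the middle
  the walk ends above its start, so the coordinate is not yet maximal (\<open>last_min_below_top\<close>).

  This matching depends on the order of the coordinates. Averaging over all orders makes it nearly
  uniform: a given coordinate is raised with frequency at most \<open>n/D\<close>
  (\<open>card_last_min_at\<close>). The reason is an exchange: swap the raised coordinate \<open>i\<close> with an
  arbitrary coordinate \<open>j\<close>. From the resulting order and the value \<open>x\<^sub>j\<close> one can recover \<open>j\<close>,
  because if replacing one of several equal values by the value of \<open>i\<close> makes its place the last
  minimum, then no other of these places would do (\<open>last_min_swap\<close>). So the \<open>D\<close> choices of \<open>j\<close>
  multiply the number of orders by \<open>D\<close>, while only \<open>D!\<close> orders and \<open>n\<close> values are available.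

  Above the middle the same weights are used upside down. Then every layer below the middle is
  completely matched upwards and every layer above it completely matched downwards, so that there
  are at most \<open>N\<close> chains (\<open>sources_le_middle_layer_size\<close>).
\<close>

section \<open>Fractional chain covers of a graded set\<close>

text \<open>
  The weights \<open>f\<close> describe a walk which starts at \<open>y\<close> with mass \<open>1\<close> minus the in-sum of \<open>y\<close>, moves
  from \<open>x\<close> to \<open>y\<close> with probability \<open>f x y\<close> and otherwise stops. Then every point of \<open>V\<close> is visited
  with total mass exactly \<open>1\<close>: this is a chain cover with fractional multiplicities.
\<close>

locale graded_flow =
  fixes V :: "'v set" and rk :: "'v \<Rightarrow> nat" and f :: "'v \<Rightarrow> 'v \<Rightarrow> real"
  assumes finite_V: "finite V"
    and nonneg: "f x y \<ge> 0"
    and out_le_1: "x \<in> V \<Longrightarrow> (\<Sum>y\<in>V. f x y) \<le> 1"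
    and in_le_1: "y \<in> V \<Longrightarrow> (\<Sum>x\<in>V. f x y) \<le> 1"
    and graded: "x \<in> V \<Longrightarrow> y \<in> V \<Longrightarrow> f x y \<noteq> 0 \<Longrightarrow> rk y = Suc (rk x)"
begin

text \<open>
  The total mass of the walks, i.e. the fractional number of chains.
\<close>

definition sources :: real where
  "sources = (\<Sum>y\<in>V. 1 - (\<Sum>x\<in>V. f x y))"

fun path_weight :: "nat \<Rightarrow> 'v \<Rightarrow> 'v \<Rightarrow> real" where
  "path_weight 0 x y = (if x = y then 1 else 0)"
| "path_weight (Suc d) x y = (\<Sum>z\<in>V. path_weight d x z * f z y)"

text \<open>
  Read backwards, the walk steps from \<open>y\<close> down to \<open>x\<close> with probability \<open>f x y\<close>. The value \<open>hit X a y\<close>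
  is the probability that the backward walk from \<open>y\<close> meets at least \<open>a\<close> points of \<open>X\<close> strictly
  below \<open>y\<close>. The argument \<open>l\<close> bounds the number of steps and makes the recursion terminate; a walk
  from \<open>y\<close> has no more than \<open>rk y\<close> steps.
\<close>

fun hit_upto :: "'v set \<Rightarrow> nat \<Rightarrow> nat \<Rightarrow> 'v \<Rightarrow> real" where
  "hit_upto X l 0 y = 1"
| "hit_upto X 0 (Suc a) y = 0"
| "hit_upto X (Suc l) (Suc a) y =
     (\<Sum>x\<in>V. f x y * (if x \<in> X then hit_upto X l a x else hit_upto X l (Suc a) x))"

definition hit :: "'v set \<Rightarrow> nat \<Rightarrow> 'v \<Rightarrow> real" where
  "hit X a y = hit_upto X (rk y) a y"

lemma path_weight_nonneg: "path_weight d x y \<ge> 0"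
  by (induction d arbitrary: y) (auto intro!: sum_nonneg mult_nonneg_nonneg nonneg)

lemma hit_0 [simp]: "hit X 0 y = 1"
  by (simp add: hit_def)

lemma hit_Suc:
  assumes "y \<in> V"
  shows "hit X (Suc a) y = (\<Sum>x\<in>V. f x y * (if x \<in> X then hit X a x else hit X (Suc a) x))"
proof (cases "rk y")
  case 0
  have "f x y = 0" if "x \<in> V" for x
    using graded[OF that assms] 0 by auto
  then show ?thesis using 0 by (simp add: hit_def)
next
  case (Suc l)
  have "f x y * (if x \<in> X then hit_upto X l a x else hit_upto X l (Suc a) x)
      = f x y * (if x \<in> X then hit X a x else hit X (Suc a) x)" if "x \<in> V" for x
    using graded[OF that assms] Suc by (cases "f x y = 0") (auto simp: hit_def)
  then show ?thesis
    unfolding hit_def[of X "Suc a" y] Suc hit_upto.simps by (rule sum.cong[OF refl])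
qed

lemma hit_upto_bounds: "y \<in> V \<Longrightarrow> 0 \<le> hit_upto X l a y \<and> hit_upto X l a y \<le> 1"
proof (induction X l a y rule: hit_upto.induct)
  case (3 X l a y)
  let ?g = "\<lambda>x. if x \<in> X then hit_upto X l a x else hit_upto X l (Suc a) x"
  have g: "0 \<le> ?g x \<and> ?g x \<le> 1" if "x \<in> V" for x
    using 3 that by auto
  have "(\<Sum>x\<in>V. f x y * ?g x) \<le> (\<Sum>x\<in>V. f x y)"
    by (intro sum_mono mult_left_le nonneg) (use g in auto)
  also have "\<dots> \<le> 1" using in_le_1 3 by auto
  finally have "(\<Sum>x\<in>V. f x y * ?g x) \<le> 1" .
  moreover have "0 \<le> (\<Sum>x\<in>V. f x y * ?g x)"
    using g by (intro sum_nonneg mult_nonneg_nonneg nonneg) auto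
  ultimately show ?case by simp
qed auto

lemma hit_le_1: "y \<in> V \<Longrightarrow> hit X a y \<le> 1"
  using hit_upto_bounds by (simp add: hit_def)

text \<open>
  The left-hand side is the expected number of points \<open>x \<in> X\<close> on a chain that have exactly \<open>a\<close>
  points of \<open>X\<close> below them on it. A chain contains at most one such point, so the expectation is at
  most the number of chains. For the proof, the recursion for \<open>1 - hit\<close> is summed over all \<open>y\<close>; since
  the out-sums are at most \<open>1\<close>, the steps contribute at most the same sum with the count advanced at
  the points of \<open>X\<close>, and the starts contribute the number of chains.
\<close>

lemma hit_drop_le_sources:
  assumes "X \<subseteq> V"
  shows "(\<Sum>x\<in>X. hit X a x - hit X (Suc a) x) \<le> sources"
proof -
  let ?g = "\<lambda>x. if x \<in> X then hit X a x else hit X (Suc a) x"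
  have "(\<Sum>y\<in>V. 1 - hit X (Suc a) y)
      = (\<Sum>y\<in>V. (1 - (\<Sum>x\<in>V. f x y)) + (\<Sum>x\<in>V. f x y * (1 - ?g x)))"
  proof (rule sum.cong[OF refl])
    fix y assume y: "y \<in> V"
    show "1 - hit X (Suc a) y = (1 - (\<Sum>x\<in>V. f x y)) + (\<Sum>x\<in>V. f x y * (1 - ?g x))"
      unfolding hit_Suc[OF y] right_diff_distrib sum_subtractf by simp
  qed
  also have "\<dots> = sources + (\<Sum>y\<in>V. \<Sum>x\<in>V. f x y * (1 - ?g x))"
    by (simp only: sources_def sum.distrib)
  finally have misses: "(\<Sum>y\<in>V. 1 - hit X (Suc a) y)
      = sources + (\<Sum>y\<in>V. \<Sum>x\<in>V. f x y * (1 - ?g x))" .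
  have "(\<Sum>y\<in>V. \<Sum>x\<in>V. f x y * (1 - ?g x)) = (\<Sum>x\<in>V. (\<Sum>y\<in>V. f x y) * (1 - ?g x))"
    unfolding sum_distrib_right by (rule sum.swap)
  also have "\<dots> \<le> (\<Sum>x\<in>V. 1 - ?g x)"
  proof (rule sum_mono)
    fix x assume "x \<in> V"
    then have "?g x \<le> 1" by (simp add: hit_le_1)
    then show "(\<Sum>y\<in>V. f x y) * (1 - ?g x) \<le> 1 - ?g x"
      using out_le_1[OF \<open>x \<in> V\<close>] by (intro mult_left_le_one_le) (auto intro: sum_nonneg nonneg)
  qed
  finally have "(\<Sum>y\<in>V. 1 - hit X (Suc a) y) - (\<Sum>x\<in>V. 1 - ?g x) \<le> sources"
    using misses by linarith
  moreover have "(\<Sum>y\<in>V. 1 - hit X (Suc a) y) - (\<Sum>x\<in>V. 1 - ?g x)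
      = (\<Sum>x\<in>V. ?g x - hit X (Suc a) x)"
    unfolding sum_subtractf[symmetric] by (rule sum.cong) auto
  moreover have "(\<Sum>x\<in>V. ?g x - hit X (Suc a) x) = (\<Sum>x\<in>X. hit X a x - hit X (Suc a) x)"
    using assms finite_V by (intro sum.mono_neutral_cong_right) auto
  ultimately show ?thesis by simp
qed

text \<open>
  All but the lowest \<open>a\<close> points of \<open>X\<close> on a chain have \<open>a\<close> points of \<open>X\<close> below them.
\<close>

lemma card_minus_sources_le_hit:
  assumes "X \<subseteq> V"
  shows "real (card X) - real a * sources \<le> (\<Sum>x\<in>X. hit X a x)"
proof (induction a)
  case (Suc a)
  then show ?case
    using hit_drop_le_sources[OF assms, of a] by (simp add: sum_subtractf algebra_simps)
qed simp

text \<open>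
  If the backward walk from \<open>y\<close> meets \<open>a\<close> points of \<open>X\<close> below \<open>y\<close>, the last of them is at distance at least
  \<open>a\<close>, so this is a union bound over the possible positions of such a point. For \<open>a = 0\<close> the point \<open>y\<close>
  itself serves, and has to be in \<open>X\<close>.
\<close>

lemma hit_le_path_weights:
  assumes "X \<subseteq> V" "y \<in> V" "y \<in> X \<or> a > 0"
  shows "hit X a y \<le> (\<Sum>x\<in>X. \<Sum>d\<in>{a..rk y}. path_weight d x y)"
  using assms(2,3)
proof (induction "rk y" arbitrary: a y rule: less_induct)
  case less
  have fX: "finite X" using assms(1) finite_V finite_subset by blast
  show ?case
  proof (cases a)
    case 0
    then have "y \<in> X" using less.prems by auto
    have "path_weight 0 y y \<le> (\<Sum>d\<in>{0..rk y}. path_weight d y y)"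
      by (intro member_le_sum path_weight_nonneg) auto
    then have "1 \<le> (\<Sum>d\<in>{0..rk y}. path_weight d y y)" by simp
    also have "\<dots> \<le> (\<Sum>x\<in>X. \<Sum>d\<in>{0..rk y}. path_weight d x y)"
      by (rule member_le_sum[where f = "\<lambda>x. \<Sum>d\<in>{0..rk y}. path_weight d x y"])
        (use \<open>y \<in> X\<close> fX in \<open>auto intro!: sum_nonneg path_weight_nonneg\<close>)
    finally show ?thesis using 0 by simp
  next
    case (Suc b)
    have step: "f z y * (if z \<in> X then hit X b z else hit X (Suc b) z)
        \<le> f z y * (\<Sum>x\<in>X. \<Sum>d\<in>{b..<rk y}. path_weight d x z)" if z: "z \<in> V" for z
    proof (cases "f z y = 0")
      case False
      then have r: "rk y = Suc (rk z)" using graded z less.prems by blast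
      have "(if z \<in> X then hit X b z else hit X (Suc b) z)
          \<le> (\<Sum>x\<in>X. \<Sum>d\<in>{b..rk z}. path_weight d x z)"
      proof (cases "z \<in> X")
        case True
        then show ?thesis using less.hyps[of z b] r z by simp
      next
        case False
        have "hit X (Suc b) z \<le> (\<Sum>x\<in>X. \<Sum>d\<in>{Suc b..rk z}. path_weight d x z)"
          using less.hyps[of z "Suc b"] r z by simp
        also have "\<dots> \<le> (\<Sum>x\<in>X. \<Sum>d\<in>{b..rk z}. path_weight d x z)"
          by (intro sum_mono sum_mono2) (auto intro: path_weight_nonneg)
        finally show ?thesis using False by simp
      qed
      moreover have "{b..rk z} = {b..<rk y}" using r by auto
      ultimately show ?thesis by (intro mult_left_mono nonneg) simp
    qed simp
    have "hit X a y \<le> (\<Sum>z\<in>V. f z y * (\<Sum>x\<in>X. \<Sum>d\<in>{b..<rk y}. path_weight d x z))"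
      unfolding Suc hit_Suc[OF less.prems(1)] by (intro sum_mono step)
    also have "\<dots> = (\<Sum>z\<in>V. \<Sum>x\<in>X. \<Sum>d\<in>{b..<rk y}. path_weight d x z * f z y)"
      by (simp add: sum_distrib_left mult.commute)
    also have "\<dots> = (\<Sum>x\<in>X. \<Sum>d\<in>{b..<rk y}. path_weight (Suc d) x y)"
      by (subst sum.swap, rule sum.cong[OF refl], subst sum.swap) simp
    also have "\<dots> = (\<Sum>x\<in>X. \<Sum>d\<in>{a..rk y}. path_weight d x y)"
      unfolding Suc atLeastLessThanSuc_atLeastAtMost[symmetric] sum.shift_bounds_Suc_ivl ..
    finally show ?thesis .
  qed
qed

lemma card_minus_sources_le_path_weights:
  assumes "X \<subseteq> V"
  shows "real (card X) - real a * sources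
     \<le> (\<Sum>y\<in>X. \<Sum>x\<in>X. \<Sum>d\<in>{a..rk y}. path_weight d x y)"
proof (cases a)
  case 0
  have "real (card X) = (\<Sum>y\<in>X. hit X 0 y)" by simp
  also have "\<dots> \<le> (\<Sum>y\<in>X. \<Sum>x\<in>X. \<Sum>d\<in>{0..rk y}. path_weight d x y)"
    using assms by (intro sum_mono hit_le_path_weights) auto
  finally show ?thesis using 0 by simp
next
  case (Suc b)
  have "(\<Sum>y\<in>X. hit X a y) \<le> (\<Sum>y\<in>X. \<Sum>x\<in>X. \<Sum>d\<in>{a..rk y}. path_weight d x y)"
    using assms Suc by (intro sum_mono hit_le_path_weights) auto
  then show ?thesis using card_minus_sources_le_hit[OF assms, of a] by linarith
qed

lemma path_weight_rank:
  assumes "x \<in> V" "y \<in> V" "path_weight d x y \<noteq> 0"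
  shows "rk y = rk x + d"
  using assms(2,3)
proof (induction d arbitrary: y)
  case (Suc d)
  then obtain z where "z \<in> V" "path_weight d x z * f z y \<noteq> 0"
    by (auto elim: sum.not_neutral_contains_not_neutral)
  then show ?case using Suc graded[of z y] by auto
qed (auto split: if_splits)

end

section \<open>Raising the last minimum\<close>

definition rank :: "nat \<Rightarrow> (nat \<Rightarrow> nat) \<Rightarrow> nat" where
  "rank D x = (\<Sum>i\<in>{1..D}. x i)"

text \<open>
  Coordinate \<open>s\<close> is a block of \<open>x s\<close> down-steps followed by \<open>n - 1 - x s\<close> up-steps. The dip at \<open>t\<close> is the
  lowest height that the walk reaches within block \<open>t\<close>; the minimum of the walk is the smallest dip.
\<close>

definition dip :: "nat \<Rightarrow> (nat \<Rightarrow> nat) \<Rightarrow> nat \<Rightarrow> int" where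
  "dip n x t = (\<Sum>s\<in>{1..<t}. int n - 1 - 2 * int (x s)) - int (x t)"

definition last_min :: "nat \<Rightarrow> nat \<Rightarrow> (nat \<Rightarrow> nat) \<Rightarrow> nat \<Rightarrow> bool" where
  "last_min n D x t \<longleftrightarrow> t \<in> {1..D} \<and>
     (\<forall>s\<in>{1..D}. dip n x t \<le> dip n x s) \<and> (\<forall>s\<in>{t<..D}. dip n x t < dip n x s)"

definition raises :: "nat \<Rightarrow> nat \<Rightarrow> (nat \<Rightarrow> nat) \<Rightarrow> (nat \<Rightarrow> nat) \<Rightarrow> bool" where
  "raises n D x y \<longleftrightarrow> (\<exists>t. last_min n D x t \<and> y = x(t := Suc (x t)))"

lemma dip_upd_before: "t < s \<Longrightarrow> dip n (x(s := v)) t = dip n x t"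
  unfolding dip_def by (auto intro!: sum.cong)

lemma dip_upd_at: "dip n (x(t := v)) t = dip n x t + int (x t) - int v"
  unfolding dip_def by (auto intro!: sum.cong)

lemma dip_upd_after:
  assumes "1 \<le> s" "s < t"
  shows "dip n (x(s := v)) t = dip n x t + 2 * (int (x s) - int v)"
proof -
  have s: "s \<in> {1..<t}" using assms by auto
  have "(\<Sum>r\<in>{1..<t}. int n - 1 - 2 * int ((x(s := v)) r))
      = (int n - 1 - 2 * int v) + (\<Sum>r\<in>{1..<t} - {s}. int n - 1 - 2 * int (x r))"
    by (subst sum.remove[OF _ s]) (auto intro!: sum.cong)
  moreover have "(\<Sum>r\<in>{1..<t}. int n - 1 - 2 * int (x r))
      = (int n - 1 - 2 * int (x s)) + (\<Sum>r\<in>{1..<t} - {s}. int n - 1 - 2 * int (x r))"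
    by (subst sum.remove[OF _ s]) auto
  ultimately show ?thesis using assms by (simp add: dip_def)
qed

lemma last_minD:
  assumes "last_min n D x t"
  shows "t \<in> {1..D}" and "s \<in> {1..D} \<Longrightarrow> dip n x t \<le> dip n x s"
    and "s \<in> {1..D} \<Longrightarrow> t < s \<Longrightarrow> dip n x t < dip n x s"
  using assms by (auto simp: last_min_def)

lemma last_min_unique:
  assumes "last_min n D x s" "last_min n D x t"
  shows "s = t"
proof (rule linorder_cases[of s t])
  assume "s < t"
  then show ?thesis using last_minD[OF assms(1)] last_minD[OF assms(2)] by (meson leD)
next
  assume "t < s"
  then show ?thesis using last_minD[OF assms(1)] last_minD[OF assms(2)] by (meson leD)
qed

lemma last_min_exists:
  assumes "D \<ge> 1"
  shows "\<exists>t. last_min n D x t"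
proof -
  define m where "m = Min (dip n x ` {1..D})"
  define T where "T = {t \<in> {1..D}. dip n x t = m}"
  have m_le: "m \<le> dip n x s" if "s \<in> {1..D}" for s
    using that by (simp add: m_def)
  have "m \<in> dip n x ` {1..D}" unfolding m_def using assms by (intro Min_in) auto
  then have "T \<noteq> {}" by (auto simp: T_def)
  have fin: "finite T" by (simp add: T_def)
  have ge: "s \<le> Max T" if "s \<in> T" for s using Max_ge[OF fin that] .
  have "Max T \<in> T" using fin \<open>T \<noteq> {}\<close> by (rule Max_in)
  then have t: "Max T \<in> {1..D}" "dip n x (Max T) = m" by (auto simp: T_def)
  have "dip n x (Max T) < dip n x s" if "s \<in> {1..D}" "Max T < s" for s
  proof -
    have "s \<notin> T" using ge[of s] that(2) by linarith
    then have "dip n x s \<noteq> m" using that(1) by (simp add: T_def)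
    then show ?thesis using m_le[OF that(1)] t(2) by simp
  qed
  then have "last_min n D x (Max T)" unfolding last_min_def using t m_le by auto
  then show ?thesis ..
qed

text \<open>
  Raising \<open>x t\<close> lowers the dip at \<open>t\<close> by one and all later dips by two. The later ones were strictly
  larger, so \<open>t\<close> remains a minimum, and it becomes the first one.
\<close>

lemma last_min_raised:
  assumes "last_min n D x t" "s \<in> {1..D}"
  defines "y \<equiv> x(t := Suc (x t))"
  shows "dip n y t \<le> dip n y s" and "s < t \<Longrightarrow> dip n y t < dip n y s"
proof -
  have t: "t \<in> {1..D}" using assms by (simp add: last_min_def)
  have y: "dip n y t = dip n x t - 1" by (simp add: y_def dip_upd_at)
  show *: "dip n y t < dip n y s" if "s < t"
    using last_minD(2)[OF assms(1,2)] y that by (simp add: y_def dip_upd_before)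
  show "dip n y t \<le> dip n y s"
  proof (cases s t rule: linorder_cases)
    case greater
    then have "dip n y s = dip n x s - 2" using t by (simp add: y_def dip_upd_after)
    then show ?thesis using last_minD(3)[OF assms(1,2) greater] y by simp
  qed (use * in simp_all)
qed

lemma raises_injective:
  assumes "raises n D x z" "raises n D y z"
  shows "x = y"
proof -
  obtain s where s: "last_min n D x s" "z = x(s := Suc (x s))" using assms(1) by (auto simp: raises_def)
  obtain t where t: "last_min n D y t" "z = y(t := Suc (y t))" using assms(2) by (auto simp: raises_def)
  have "s \<in> {1..D}" "t \<in> {1..D}" using s t by (auto simp: last_min_def)
  then have "s = t"
    using last_min_raised[OF s(1), folded s(2), of t] last_min_raised[OF t(1), folded t(2), of s]
    by linarith
  show "x = y"
  proof
    fix i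
    show "x i = y i"
      using fun_cong[OF s(2), of i] fun_cong[OF t(2), of i] \<open>s = t\<close> by (auto split: if_splits)
  qed
qed

text \<open>
  If \<open>x t\<close> were maximal, the walk would still be at its minimum at the end of block \<open>t\<close>. Then either the
  next dip is no larger, or the walk ends there; but below the middle the walk ends
  at a positive height, whereas its first dip is not positive.
\<close>

lemma last_min_below_top:
  assumes lm: "last_min n D x t" and low: "2 * rank D x < (n - 1) * D" and n: "n \<ge> 1"
    and le: "\<And>i. i \<in> {1..D} \<Longrightarrow> x i \<le> n - 1"
  shows "x t < n - 1"
proof (rule ccontr)
  assume "\<not> x t < n - 1"
  have t: "t \<in> {1..D}" using lm by (simp add: last_min_def)
  then have top: "x t = n - 1" using le \<open>\<not> x t < n - 1\<close> by force
  have after_t: "(\<Sum>s\<in>{1..<Suc t}. int n - 1 - 2 * int (x s)) = dip n x t"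
    using t top n by (simp add: dip_def)
  show False
  proof (cases "t = D")
    case True
    have "(\<Sum>s\<in>{1..D}. int n - 1 - 2 * int (x s)) = int D * (int n - 1) - 2 * int (rank D x)"
      by (simp add: sum_subtractf rank_def sum_distrib_left)
    also have "\<dots> > 0"
    proof -
      have "int (2 * rank D x) < int ((n - 1) * D)" using low by (subst of_nat_less_iff)
      then show ?thesis using n by (simp add: mult.commute)
    qed
    finally have "dip n x t > 0" using after_t True by (simp add: atLeastLessThanSuc_atLeastAtMost)
    moreover have "dip n x t \<le> dip n x 1"
      using lm t by (cases "t = 1") (auto simp: last_min_def)
    moreover have "dip n x 1 \<le> 0" by (simp add: dip_def)
    ultimately show False by simp
  next
    case False
    then have "Suc t \<in> {1..D}" using t by auto
    then have "dip n x t < dip n x (Suc t)" using lm by (auto simp: last_min_def)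
    moreover have "dip n x (Suc t) = dip n x t - int (x (Suc t))"
      using after_t by (simp add: dip_def)
    ultimately show False by simp
  qed
qed

text \<open>
  Two places \<open>s < t\<close> carry the same value \<open>w\<close>, and one of them is replaced by \<open>v\<close>. A last
  minimum at \<open>s\<close> in the first case forces the dips of \<open>u\<close> to satisfy \<open>dip s - dip t < w - v\<close>, a last minimum at \<open>t\<close> in the second case forces
  \<open>dip s - dip t \<ge> w - v\<close>.
\<close>

lemma last_min_swap:
  assumes eq: "u s = w" "u t = w"
    and s: "last_min n D (u(s := v)) s" and t: "last_min n D (u(t := v)) t"
  shows "s = t"
proof -
  have *: False if "s < t" "u s = w" "u t = w" "last_min n D (u(s := v)) s" "last_min n D (u(t := v)) t"
    for s t
  proof -
    have st: "s \<in> {1..D}" "t \<in> {1..D}" using that by (auto simp: last_min_def)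
    have "dip n (u(s := v)) s < dip n (u(s := v)) t" using that st by (auto simp: last_min_def)
    then have "dip n u s - dip n u t < int w - int v" using that st by (simp add: dip_upd_at dip_upd_after)
    moreover have "dip n (u(t := v)) t \<le> dip n (u(t := v)) s" using that st by (auto simp: last_min_def)
    then have "dip n u t + int w - int v \<le> dip n u s" using that by (simp add: dip_upd_at dip_upd_before)
    ultimately show False by simp
  qed
  show ?thesis using *[of s t] *[of t s] assms by (cases s t rule: linorder_cases) auto
qed

section \<open>Averaging over the order of the coordinates\<close>

lemma raises_functional:
  assumes "raises n D x y" "raises n D x z"
  shows "y = z"
proof -
  obtain s where s: "last_min n D x s" "y = x(s := Suc (x s))" using assms(1) unfolding raises_def by blast
  obtain t where t: "last_min n D x t" "z = x(t := Suc (x t))" using assms(2) unfolding raises_def by blast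
  show ?thesis using last_min_unique[OF s(1) t(1)] s(2) t(2) by simp
qed

lemma sum_card_swap:
  assumes "finite A" "finite B"
  shows "(\<Sum>b\<in>B. real (card {a \<in> A. Q a b})) = (\<Sum>a\<in>A. real (card {b \<in> B. Q a b}))"
proof -
  have 1: "real (card {a \<in> A. Q a b}) = (\<Sum>a\<in>A. if Q a b then 1 else 0)" for b
    using assms(1) by (simp flip: sum.inter_filter)
  have 2: "real (card {b \<in> B. Q a b}) = (\<Sum>b\<in>B. if Q a b then 1 else 0)" for a
    using assms(2) by (simp flip: sum.inter_filter)
  show ?thesis unfolding 1 2 by (rule sum.swap)
qed

lemma finite_grid: "finite (grid n D)"
  by (simp add: grid_def finite_PiE)

lemma grid_less: "x \<in> grid n D \<Longrightarrow> i \<in> {1..D} \<Longrightarrow> x i < n"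
  by (auto simp: grid_def PiE_iff)

lemma grid_permuted:
  assumes "x \<in> grid n D" "\<sigma> permutes {1..D}"
  shows "x \<circ> \<sigma> \<in> grid n D"
  using assms permutes_in_image[OF assms(2)] permutes_not_in[OF assms(2)]
  by (auto simp: grid_def PiE_iff extensional_def)

lemma rank_permuted:
  assumes "\<sigma> permutes {1..D}"
  shows "rank D (x \<circ> \<sigma>) = rank D x"
  using sum.permute[OF assms, of x] by (simp add: rank_def)

lemma rank_raised:
  assumes "i \<in> {1..D}"
  shows "rank D (x(i := Suc (x i))) = Suc (rank D x)"
  using assms by (simp add: rank_def sum.remove[of _ i])

text \<open>
  Precomposing with \<open>\<sigma>\<close> reads the coordinates in the order \<open>\<sigma> 1, \<dots>, \<sigma> D\<close>.
\<close>

definition raise_freq :: "nat \<Rightarrow> nat \<Rightarrow> (nat \<Rightarrow> nat) \<Rightarrow> (nat \<Rightarrow> nat) \<Rightarrow> real" where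
  "raise_freq n D x y =
     real (card {\<sigma> \<in> {\<sigma>. \<sigma> permutes {1..D}}. raises n D (x \<circ> \<sigma>) (y \<circ> \<sigma>)}) / fact D"

lemma raise_freq_nonneg: "raise_freq n D x y \<ge> 0"
  by (simp add: raise_freq_def)

lemma permuted_inject:
  assumes "\<sigma> permutes S" "x \<circ> \<sigma> = y \<circ> \<sigma>"
  shows "x = y"
  using assms by (metis comp_assoc comp_id permutes_inv_o(1))

lemma card_perms: "card {\<sigma>. \<sigma> permutes {Suc 0..D}} = fact D"
  by (simp add: card_permutations)

lemma finite_perms: "finite {\<sigma>. \<sigma> permutes {1..D::nat}}"
  by (simp add: finite_permutations)

lemma sum_raise_freq_out:
  "(\<Sum>y\<in>grid n D. raise_freq n D x y)
     = (\<Sum>\<sigma>\<in>{\<sigma>. \<sigma> permutes {1..D}}. real (card {y \<in> grid n D. raises n D (x \<circ> \<sigma>) (y \<circ> \<sigma>)})) / fact D"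
  unfolding raise_freq_def sum_divide_distrib[symmetric]
  by (subst sum_card_swap) (rule finite_perms finite_grid refl)+

lemma sum_raise_freq_in:
  "(\<Sum>x\<in>grid n D. raise_freq n D x y)
     = (\<Sum>\<sigma>\<in>{\<sigma>. \<sigma> permutes {1..D}}. real (card {x \<in> grid n D. raises n D (x \<circ> \<sigma>) (y \<circ> \<sigma>)})) / fact D"
  unfolding raise_freq_def sum_divide_distrib[symmetric]
  by (subst sum_card_swap) (rule finite_perms finite_grid refl)+

lemma card_le_1_if_unique:
  assumes "\<And>x y. x \<in> A \<Longrightarrow> y \<in> A \<Longrightarrow> x = y"
  shows "card A \<le> 1"
  by (cases "finite A") (auto simp: card_le_Suc0_iff_eq intro: assms)

lemma raise_freq_out_le_1: "(\<Sum>y\<in>grid n D. raise_freq n D x y) \<le> 1"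
proof -
  have "card {y \<in> grid n D. raises n D (x \<circ> \<sigma>) (y \<circ> \<sigma>)} \<le> 1" if "\<sigma> permutes {1..D}" for \<sigma>
  proof (rule card_le_1_if_unique)
    fix y z assume "y \<in> {y \<in> grid n D. raises n D (x \<circ> \<sigma>) (y \<circ> \<sigma>)}" "z \<in> {y \<in> grid n D. raises n D (x \<circ> \<sigma>) (y \<circ> \<sigma>)}"
    then have "y \<circ> \<sigma> = z \<circ> \<sigma>" using raises_functional by blast
    then show "y = z" using that permuted_inject by blast
  qed
  then have "(\<Sum>\<sigma>\<in>{\<sigma>. \<sigma> permutes {1..D}}. real (card {y \<in> grid n D. raises n D (x \<circ> \<sigma>) (y \<circ> \<sigma>)}))
      \<le> (\<Sum>\<sigma>\<in>{\<sigma>. \<sigma> permutes {1..D}}. 1)"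
    by (intro sum_mono) auto
  then show ?thesis unfolding sum_raise_freq_out by (simp add: card_perms)
qed

lemma raise_freq_in_le_1: "(\<Sum>x\<in>grid n D. raise_freq n D x y) \<le> 1"
proof -
  have "card {x \<in> grid n D. raises n D (x \<circ> \<sigma>) (y \<circ> \<sigma>)} \<le> 1" if "\<sigma> permutes {1..D}" for \<sigma>
  proof (rule card_le_1_if_unique)
    fix x z assume "x \<in> {x \<in> grid n D. raises n D (x \<circ> \<sigma>) (y \<circ> \<sigma>)}" "z \<in> {x \<in> grid n D. raises n D (x \<circ> \<sigma>) (y \<circ> \<sigma>)}"
    then have "x \<circ> \<sigma> = z \<circ> \<sigma>" using raises_injective by blast
    then show "x = z" using that permuted_inject by blast
  qed
  then have "(\<Sum>\<sigma>\<in>{\<sigma>. \<sigma> permutes {1..D}}. real (card {x \<in> grid n D. raises n D (x \<circ> \<sigma>) (y \<circ> \<sigma>)}))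
      \<le> (\<Sum>\<sigma>\<in>{\<sigma>. \<sigma> permutes {1..D}}. 1)"
    by (intro sum_mono) auto
  then show ?thesis unfolding sum_raise_freq_in by (simp add: card_perms)
qed

lemma raise_in_grid:
  assumes x: "x \<in> grid n D" and low: "2 * rank D x < (n - 1) * D"
  obtains y where "y \<in> grid n D" "raises n D x y"
proof -
  have "D \<ge> 1" using low by (cases D) auto
  then obtain t where t: "last_min n D x t" using last_min_exists by blast
  have "n \<ge> 1" using low by (cases n) auto
  have "x t < n - 1"
    by (rule last_min_below_top[OF t low \<open>n \<ge> 1\<close>]) (use grid_less[OF x] in fastforce)
  then have "x(t := Suc (x t)) \<in> grid n D"
    using x last_minD(1)[OF t] by (auto simp: grid_def PiE_iff extensional_def)
  then show ?thesis using t that by (auto simp: raises_def)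
qed

lemma raise_freq_out_eq_1:
  assumes x: "x \<in> grid n D" and low: "2 * rank D x < (n - 1) * D"
  shows "(\<Sum>y\<in>grid n D. raise_freq n D x y) = 1"
proof -
  have "1 \<le> card {y \<in> grid n D. raises n D (x \<circ> \<sigma>) (y \<circ> \<sigma>)}" if s: "\<sigma> permutes {1..D}" for \<sigma>
  proof -
    obtain y where y: "y \<in> grid n D" "raises n D (x \<circ> \<sigma>) y"
      using raise_in_grid[of "x \<circ> \<sigma>" n D] grid_permuted[OF x s] low rank_permuted[OF s] by metis
    have "(y \<circ> inv \<sigma>) \<circ> \<sigma> = y" using permutes_inv_o(2)[OF s] by (simp add: comp_assoc)
    then have "y \<circ> inv \<sigma> \<in> {y \<in> grid n D. raises n D (x \<circ> \<sigma>) (y \<circ> \<sigma>)}"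
      using y grid_permuted[OF y(1) permutes_inv[OF s]] by simp
    then have "{y \<in> grid n D. raises n D (x \<circ> \<sigma>) (y \<circ> \<sigma>)} \<noteq> {}" by blast
    then show ?thesis using finite_grid[of n D] by (simp add: Suc_le_eq card_gt_0_iff)
  qed
  then have "(\<Sum>\<sigma>\<in>{\<sigma>. \<sigma> permutes {1..D}}. 1)
      \<le> (\<Sum>\<sigma>\<in>{\<sigma>. \<sigma> permutes {1..D}}. real (card {y \<in> grid n D. raises n D (x \<circ> \<sigma>) (y \<circ> \<sigma>)}))"
    by (intro sum_mono) auto
  then have "1 \<le> (\<Sum>y\<in>grid n D. raise_freq n D x y)"
    unfolding sum_raise_freq_out by (simp add: card_perms)
  then show ?thesis using raise_freq_out_le_1[of n D x] by linarith
qed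

lemma raises_permutedD:
  assumes "\<sigma> permutes {1..D}" "raises n D (x \<circ> \<sigma>) (y \<circ> \<sigma>)"
  obtains t where "last_min n D (x \<circ> \<sigma>) t" "\<sigma> t \<in> {1..D}" "y = x(\<sigma> t := Suc (x (\<sigma> t)))"
proof -
  obtain t where t: "last_min n D (x \<circ> \<sigma>) t" "y \<circ> \<sigma> = (x \<circ> \<sigma>)(t := Suc ((x \<circ> \<sigma>) t))"
    using assms(2) by (auto simp: raises_def)
  have "x(\<sigma> t := Suc (x (\<sigma> t))) \<circ> \<sigma> = (x \<circ> \<sigma>)(t := Suc ((x \<circ> \<sigma>) t))"
    using permutes_inj[OF assms(1)] by (auto simp: fun_eq_iff inj_eq)
  then have "y = x(\<sigma> t := Suc (x (\<sigma> t)))"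
    using t(2) permuted_inject[OF assms(1)] by metis
  then show ?thesis using that t(1) last_minD(1)[OF t(1)] permutes_in_image[OF assms(1)] by blast
qed

lemma raise_freq_support:
  assumes "raise_freq n D x y \<noteq> 0"
  obtains i where "i \<in> {1..D}" "y = x(i := Suc (x i))"
proof -
  have "{\<sigma> \<in> {\<sigma>. \<sigma> permutes {1..D}}. raises n D (x \<circ> \<sigma>) (y \<circ> \<sigma>)} \<noteq> {}"
    using assms unfolding raise_freq_def by (metis card.empty div_0 of_nat_0)
  then show ?thesis using that raises_permutedD by blast
qed

lemma raise_freq_rank: "raise_freq n D x y \<noteq> 0 \<Longrightarrow> rank D y = Suc (rank D x)"
  by (erule raise_freq_support) (simp add: rank_raised)

text \<open>
  The heart of the proof. For an order \<open>\<tau>\<close> in which \<open>i\<close> is raised and any \<open>j\<close>, exchange \<open>i\<close> and \<open>j\<close> to get an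
  order \<open>\<sigma>\<close>. Given \<open>\<sigma>\<close> and \<open>w = x j\<close>, overwrite the value of \<open>i\<close> by \<open>w\<close> in the word of \<open>\<sigma>\<close>. The
  word of \<open>\<tau>\<close> arises from this word \<open>u\<close> when one entry equal to \<open>w\<close>, at the place of \<open>j\<close>,
  is replaced by \<open>x i\<close>, and this makes it the last minimum. By \<open>last_min_swap\<close>
  only one place is possible, so \<open>j\<close>, and with it \<open>\<tau>\<close>, is determined.
\<close>

lemma card_last_min_at:
  assumes x: "x \<in> grid n D" and i: "i \<in> {1..D}"
  defines "E \<equiv> {\<tau>. \<tau> permutes {1..D} \<and> (\<exists>t. last_min n D (x \<circ> \<tau>) t \<and> \<tau> t = i)}"
  shows "card E * D \<le> fact D * n"
proof -
  define P where "P = {\<sigma>. \<sigma> permutes {1..D}}"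
  define \<phi> where "\<phi> = (\<lambda>(\<tau> :: nat \<Rightarrow> nat, j). (transpose i j \<circ> \<tau>, x j))"
  have exchange: "\<exists>t. \<sigma> t = j \<and> u t = w \<and> last_min n D (u(t := x i)) t"
    if \<tau>: "\<tau> \<in> E" and j: "x j = w" and \<sigma>: "\<sigma> = transpose i j \<circ> \<tau>"
      and u: "u = x(i := w) \<circ> \<sigma>" for \<tau> j \<sigma> u w
  proof -
    obtain t where t: "last_min n D (x \<circ> \<tau>) t" "\<tau> t = i" using \<tau> by (auto simp: E_def)
    have inj: "\<tau> k = i \<longleftrightarrow> k = t" for k
    proof -
      have "inj \<tau>" using \<tau> permutes_inj by (auto simp: E_def)
      then show ?thesis using t(2) inj_eq[of \<tau> k t] by simp
    qed
    have "x \<circ> \<tau> = u(t := x i)"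
      unfolding u \<sigma> using j by (auto simp: fun_eq_iff transpose_def inj t(2))
    moreover have "\<sigma> t = j" "u t = w" using t(2) j by (simp_all add: \<sigma> u)
    ultimately show ?thesis using t(1) by metis
  qed
  have "inj_on \<phi> (E \<times> {1..D})"
  proof (rule inj_onI, clarify)
    fix \<tau> j \<tau>' j' assume \<tau>: "\<tau> \<in> E" and \<tau>': "\<tau>' \<in> E" and "\<phi> (\<tau>, j) = \<phi> (\<tau>', j')"
    then have eq: "transpose i j \<circ> \<tau> = transpose i j' \<circ> \<tau>'" "x j' = x j" by (auto simp: \<phi>_def)
    define \<sigma> where "\<sigma> = transpose i j \<circ> \<tau>"
    define u where "u = x(i := x j) \<circ> \<sigma>"
    obtain t where t: "\<sigma> t = j" "u t = x j" "last_min n D (u(t := x i)) t"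
      using exchange[OF \<tau> refl \<sigma>_def u_def] by blast
    obtain s where s: "\<sigma> s = j'" "u s = x j" "last_min n D (u(s := x i)) s"
      using exchange[OF \<tau>' eq(2) \<sigma>_def[unfolded eq(1)] u_def] by blast
    have "t = s" using last_min_swap[OF t(2) s(2) t(3) s(3)] .
    then have "j = j'" using t s by simp
    have "\<tau> = transpose i j \<circ> (transpose i j \<circ> \<tau>)" by (simp flip: comp_assoc)
    also have "\<dots> = transpose i j \<circ> (transpose i j \<circ> \<tau>')" using eq(1) \<open>j = j'\<close> by simp
    also have "\<dots> = \<tau>'" by (simp flip: comp_assoc)
    finally show "\<tau> = \<tau>' \<and> j = j'" using \<open>j = j'\<close> by simp
  qed
  moreover have "\<phi> ` (E \<times> {1..D}) \<subseteq> P \<times> {0..<n}"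
  proof
    fix p assume "p \<in> \<phi> ` (E \<times> {1..D})"
    then obtain \<tau> j where p: "p = (transpose i j \<circ> \<tau>, x j)" "\<tau> permutes {1..D}" "j \<in> {1..D}"
      by (auto simp: \<phi>_def E_def)
    then show "p \<in> P \<times> {0..<n}"
      using permutes_compose[OF p(2) permutes_swap_id[OF i p(3)]] grid_less[OF x p(3)]
      by (simp add: P_def)
  qed
  moreover have "finite (P \<times> {0..<n})" unfolding P_def by (intro finite_cartesian_product finite_perms) simp
  ultimately have "card (E \<times> {1..D}) \<le> card (P \<times> {0..<n})" by (rule card_inj_on_le)
  then show ?thesis by (simp add: card_cartesian_product P_def card_perms)
qed

lemma raise_freq_le:
  assumes x: "x \<in> grid n D"
  shows "raise_freq n D x y \<le> real n / real D"
proof (cases "raise_freq n D x y = 0")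
  case False
  then obtain i where i: "i \<in> {1..D}" "y = x(i := Suc (x i))" by (rule raise_freq_support)
  let ?E = "{\<tau>. \<tau> permutes {1..D} \<and> (\<exists>t. last_min n D (x \<circ> \<tau>) t \<and> \<tau> t = i)}"
  have "{\<sigma> \<in> {\<sigma>. \<sigma> permutes {1..D}}. raises n D (x \<circ> \<sigma>) (y \<circ> \<sigma>)} \<subseteq> ?E"
  proof clarify
    fix \<sigma> assume s: "\<sigma> permutes {1..D}" and r: "raises n D (x \<circ> \<sigma>) (y \<circ> \<sigma>)"
    obtain t where t: "last_min n D (x \<circ> \<sigma>) t" "y = x(\<sigma> t := Suc (x (\<sigma> t)))"
      using raises_permutedD[OF s r] by blast
    have "\<sigma> t = i" using fun_cong[OF t(2), of i] i(2) by (auto split: if_splits)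
    then show "\<exists>t. last_min n D (x \<circ> \<sigma>) t \<and> \<sigma> t = i" using t by blast
  qed
  then have "card {\<sigma> \<in> {\<sigma>. \<sigma> permutes {1..D}}. raises n D (x \<circ> \<sigma>) (y \<circ> \<sigma>)} \<le> card ?E"
    by (rule card_mono[rotated]) (rule finite_subset[OF _ finite_perms], blast)
  then have "raise_freq n D x y \<le> real (card ?E) / fact D"
    unfolding raise_freq_def by (intro divide_right_mono) auto
  also have "\<dots> \<le> real n / real D"
  proof -
    have "real (card ?E * D) \<le> real (fact D * n)"
      using card_last_min_at[OF x i(1)] by (rule of_nat_mono)
    moreover have "D > 0" using i by auto
    ultimately show ?thesis by (simp add: field_simps)
  qed
  finally show ?thesis .
qed simp

section \<open>A near-uniform flow covering the grid\<close>

definition reflect :: "nat \<Rightarrow> nat \<Rightarrow> (nat \<Rightarrow> nat) \<Rightarrow> (nat \<Rightarrow> nat)" where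
  "reflect n D x = (\<lambda>i\<in>{1..D}. n - 1 - x i)"

lemma reflect_in_grid:
  assumes "x \<in> grid n D"
  shows "reflect n D x \<in> grid n D"
  using assms by (fastforce simp: grid_def reflect_def PiE_iff)

lemma reflect_reflect:
  assumes "x \<in> grid n D"
  shows "reflect n D (reflect n D x) = x"
proof
  fix i
  show "reflect n D (reflect n D x) i = x i"
  proof (cases "i \<in> {1..D}")
    case True
    then show ?thesis using grid_less[OF assms True] by (simp add: reflect_def)
  next
    case False
    then show ?thesis using assms by (auto simp: reflect_def grid_def PiE_iff extensional_def)
  qed
qed

lemma bij_reflect: "bij_betw (reflect n D) (grid n D) (grid n D)"
  by (rule bij_betw_byWitness[where f' = "reflect n D"]) (auto simp: reflect_in_grid reflect_reflect)

lemma rank_reflect: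
  assumes "x \<in> grid n D"
  shows "rank D (reflect n D x) + rank D x = (n - 1) * D"
proof -
  have "rank D (reflect n D x) + rank D x = (\<Sum>i\<in>{1..D}. n - 1)"
    unfolding rank_def sum.distrib[symmetric]
  proof (rule sum.cong[OF refl])
    fix i assume i: "i \<in> {1..D}"
    then show "reflect n D x i + x i = n - 1" using grid_less[OF assms i] by (simp add: reflect_def)
  qed
  then show ?thesis by simp
qed

text \<open>
  Raising is used to leave the layers below the middle one. Above, the picture is turned upside down:
  \<open>x\<close> is reached from \<open>y\<close> by lowering a coordinate, that is, by raising it in the reflected points.
\<close>

definition flow :: "nat \<Rightarrow> nat \<Rightarrow> (nat \<Rightarrow> nat) \<Rightarrow> (nat \<Rightarrow> nat) \<Rightarrow> real" where
  "flow n D x y = (if rank D x < (n - 1) * D div 2 then raise_freq n D x y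
     else raise_freq n D (reflect n D y) (reflect n D x))"

lemma flow_nonneg: "flow n D x y \<ge> 0"
  by (simp add: flow_def raise_freq_nonneg)

lemma flow_le:
  assumes "y \<in> grid n D" "x \<in> grid n D"
  shows "flow n D x y \<le> real n / real D"
  using assms by (simp add: flow_def raise_freq_le reflect_in_grid)

lemma flow_support:
  assumes x: "x \<in> grid n D" and y: "y \<in> grid n D" and nz: "flow n D x y \<noteq> 0"
  obtains i where "i \<in> {1..D}" "y = x(i := Suc (x i))"
proof (cases "rank D x < (n - 1) * D div 2")
  case True
  then show ?thesis using nz that raise_freq_support[of n D x y] by (auto simp: flow_def)
next
  case False
  then have "raise_freq n D (reflect n D y) (reflect n D x) \<noteq> 0" using nz by (simp add: flow_def)
  then obtain i where i: "i \<in> {1..D}"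
    and eq: "reflect n D x = (reflect n D y)(i := Suc (reflect n D y i))"
    by (rule raise_freq_support)
  have "y k = (x(i := Suc (x i))) k" for k
  proof (cases "k \<in> {1..D}")
    case True
    have "x k < n" "y k < n" using grid_less[OF x True] grid_less[OF y True] by auto
    then show ?thesis using fun_cong[OF eq, of k] True
      by (auto simp: reflect_def split: if_splits)
  next
    case False
    then show ?thesis using i x y by (auto simp: grid_def PiE_iff extensional_def)
  qed
  then show ?thesis using that i by blast
qed

lemma flow_rank:
  assumes "x \<in> grid n D" "y \<in> grid n D" "flow n D x y \<noteq> 0"
  shows "rank D y = Suc (rank D x)"
  using flow_support[OF assms] rank_raised by metis

lemma raise_freq_reflect_rank:
  assumes "x \<in> grid n D" "y \<in> grid n D" "raise_freq n D (reflect n D y) (reflect n D x) \<noteq> 0"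
  shows "rank D y = Suc (rank D x)"
  using raise_freq_rank[OF assms(3)] rank_reflect[OF assms(1)] rank_reflect[OF assms(2)] by linarith

lemma sum_reflect: "(\<Sum>x\<in>grid n D. g (reflect n D x)) = (\<Sum>x\<in>grid n D. g x)"
  by (rule sum.reindex_bij_betw[OF bij_reflect])

text \<open>
  Weights join consecutive layers only, so the layer of the upper end point also
  decides which of the two cases of the definition applies.
\<close>

lemma flow_in_lower:
  assumes "y \<in> grid n D" "rank D y \<le> (n - 1) * D div 2" "x \<in> grid n D"
  shows "flow n D x y = raise_freq n D x y"
  using raise_freq_rank[of n D x y] raise_freq_reflect_rank[OF assms(3,1)] assms(2)
  by (force simp: flow_def)

lemma flow_in_upper:
  assumes "y \<in> grid n D" "rank D y > (n - 1) * D div 2" "x \<in> grid n D"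
  shows "flow n D x y = raise_freq n D (reflect n D y) (reflect n D x)"
  using raise_freq_rank[of n D x y] raise_freq_reflect_rank[OF assms(3,1)] assms(2)
  by (force simp: flow_def)

lemma flow_in_upper_eq_1:
  assumes y: "y \<in> grid n D" and r: "rank D y > (n - 1) * D div 2"
  shows "(\<Sum>x\<in>grid n D. flow n D x y) = 1"
proof -
  have "(\<Sum>x\<in>grid n D. flow n D x y)
      = (\<Sum>x\<in>grid n D. raise_freq n D (reflect n D y) (reflect n D x))"
    using flow_in_upper[OF y r] by (rule sum.cong[OF refl])
  also have "\<dots> = (\<Sum>x\<in>grid n D. raise_freq n D (reflect n D y) x)" by (rule sum_reflect)
  also have "\<dots> = 1"
  proof (rule raise_freq_out_eq_1[OF reflect_in_grid[OF y]])
    show "2 * rank D (reflect n D y) < (n - 1) * D" using rank_reflect[OF y] r by linarith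
  qed
  finally show ?thesis .
qed

lemma flow_in_le_1:
  assumes y: "y \<in> grid n D"
  shows "(\<Sum>x\<in>grid n D. flow n D x y) \<le> 1"
proof (cases "rank D y > (n - 1) * D div 2")
  case True
  then show ?thesis using flow_in_upper_eq_1[OF y] by simp
next
  case False
  then have "(\<Sum>x\<in>grid n D. flow n D x y) = (\<Sum>x\<in>grid n D. raise_freq n D x y)"
    using flow_in_lower[OF y] by (intro sum.cong) auto
  then show ?thesis using raise_freq_in_le_1[of n D y] by simp
qed

lemma flow_out_lower_eq_1:
  assumes "x \<in> grid n D" "rank D x < (n - 1) * D div 2"
  shows "(\<Sum>y\<in>grid n D. flow n D x y) = 1"
  using raise_freq_out_eq_1[OF assms(1)] assms(2) by (simp add: flow_def)

lemma flow_out_le_1: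
  assumes x: "x \<in> grid n D"
  shows "(\<Sum>y\<in>grid n D. flow n D x y) \<le> 1"
proof (cases "rank D x < (n - 1) * D div 2")
  case False
  then have "(\<Sum>y\<in>grid n D. flow n D x y)
      = (\<Sum>y\<in>grid n D. raise_freq n D (reflect n D y) (reflect n D x))"
    by (simp add: flow_def)
  also have "\<dots> = (\<Sum>y\<in>grid n D. raise_freq n D y (reflect n D x))"
    by (rule sum_reflect[of "\<lambda>y. raise_freq n D y (reflect n D x)"])
  finally show ?thesis using raise_freq_in_le_1[of n D "reflect n D x"] by simp
qed (use flow_out_lower_eq_1[OF x] in simp)

lemma middle_layer_rank: "n \<ge> 1 \<Longrightarrow> middle_layer n D = {x \<in> grid n D. rank D x = (n - 1) * D div 2}"
proof -
  assume n: "n \<ge> 1"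
  have "(real n - 1) / 2 * real D = real ((n - 1) * D) / real 2" using n by simp
  then have "\<lfloor>(real n - 1) / 2 * real D\<rfloor> = int ((n - 1) * D div 2)"
    by (simp only: floor_divide_of_nat_eq)
  then show ?thesis unfolding middle_layer_def rank_def by (simp only: of_nat_eq_iff)
qed

interpretation grid_flow: graded_flow "grid n D" "rank D" "flow n D" for n D
  by unfold_locales (auto simp: finite_grid flow_nonneg flow_in_le_1 flow_out_le_1 flow_rank)

text \<open>
  Below the middle layer every point sends out mass \<open>1\<close>, which arrives in the middle layer or below
  it; above the middle layer every point receives mass \<open>1\<close>. So the total mass moved is at least the
  number of points outside the middle layer.
\<close>

lemma sources_le_middle_layer_size:
  assumes "n \<ge> 1"
  shows "grid_flow.sources n D \<le> real (middle_layer_size n D)"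
proof -
  let ?G = "grid n D" and ?h = "(n - 1) * D div 2"
  let ?lo = "{x \<in> ?G. rank D x < ?h}" and ?hi = "{x \<in> ?G. rank D x > ?h}"
  let ?mid = "{x \<in> ?G. rank D x = ?h}"
  have fin: "finite ?lo" "finite ?hi" "finite ?mid" using finite_grid by auto
  have "real (card ?lo) = (\<Sum>x\<in>?lo. \<Sum>y\<in>?G. flow n D x y)"
    using flow_out_lower_eq_1 by simp
  also have "\<dots> = (\<Sum>x\<in>?lo. \<Sum>y\<in>?lo \<union> ?mid. flow n D x y)"
  proof (rule sum.cong[OF refl])
    fix x assume x: "x \<in> ?lo"
    have "flow n D x y = 0" if "y \<in> ?G - (?lo \<union> ?mid)" for y
    proof (rule ccontr)
      assume "flow n D x y \<noteq> 0"
      then have "rank D y = Suc (rank D x)" using flow_rank x that by blast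
      then show False using x that by auto
    qed
    then show "(\<Sum>y\<in>?G. flow n D x y) = (\<Sum>y\<in>?lo \<union> ?mid. flow n D x y)"
      by (intro sum.mono_neutral_right finite_grid) auto
  qed
  also have "\<dots> = (\<Sum>y\<in>?lo \<union> ?mid. \<Sum>x\<in>?lo. flow n D x y)" by (rule sum.swap)
  also have "\<dots> \<le> (\<Sum>y\<in>?lo \<union> ?mid. \<Sum>x\<in>?G. flow n D x y)"
    by (intro sum_mono sum_mono2 finite_grid flow_nonneg) auto
  finally have lo: "real (card ?lo) \<le> (\<Sum>y\<in>?lo \<union> ?mid. \<Sum>x\<in>?G. flow n D x y)" .
  have hi: "real (card ?hi) = (\<Sum>y\<in>?hi. \<Sum>x\<in>?G. flow n D x y)"
    using flow_in_upper_eq_1 by simp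
  have G: "?G = (?lo \<union> ?mid) \<union> ?hi" by auto
  have "(\<Sum>y\<in>?G. \<Sum>x\<in>?G. flow n D x y)
      = (\<Sum>y\<in>?lo \<union> ?mid. \<Sum>x\<in>?G. flow n D x y) + (\<Sum>y\<in>?hi. \<Sum>x\<in>?G. flow n D x y)"
    by (subst (1) G, rule sum.union_disjoint) (use fin in auto)
  then have total: "(\<Sum>y\<in>?G. \<Sum>x\<in>?G. flow n D x y) \<ge> real (card ?lo) + real (card ?hi)"
    using lo hi by linarith
  have "card ?G = card (?lo \<union> ?mid) + card ?hi"
    by (subst (1) G, rule card_Un_disjoint) (use fin in auto)
  moreover have "card (?lo \<union> ?mid) = card ?lo + card ?mid"
    by (rule card_Un_disjoint) (use fin in auto)
  moreover have "grid_flow.sources n D = real (card ?G) - (\<Sum>y\<in>?G. \<Sum>x\<in>?G. flow n D x y)"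
    by (simp add: grid_flow.sources_def sum_subtractf)
  ultimately show ?thesis
    using total middle_layer_rank[OF assms, of D] by (simp add: middle_layer_size_def)
qed

lemma path_weight_grid_le:
  assumes "x \<in> grid n D" "y \<in> grid n D" "grid_flow.path_weight n D d x y \<noteq> 0"
  shows "grid_le D x y"
  using assms(2,3)
proof (induction d arbitrary: y)
  case 0
  then show ?case by (auto simp: grid_le_def split: if_splits)
next
  case (Suc d)
  then obtain z where z: "z \<in> grid n D" "grid_flow.path_weight n D d x z * flow n D z y \<noteq> 0"
    by (auto elim: sum.not_neutral_contains_not_neutral)
  then obtain i where "y = z(i := Suc (z i))" using flow_support[OF z(1) Suc.prems(1)] by auto
  moreover have "grid_le D x z" using Suc.IH[OF z(1)] z(2) by simp
  ultimately show ?case by (auto simp: grid_le_def le_Suc_eq)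
qed

text \<open>
  The last step of a path from \<open>x\<close> to \<open>y\<close> of length \<open>a\<close> raises a coordinate in which \<open>x\<close> and \<open>y\<close> differ.
  There are at most \<open>a\<close> of them, which gives the factor \<open>a!\<close> by induction.
\<close>

lemma path_weight_exact_le:
  assumes x: "x \<in> grid n D" and y: "y \<in> grid n D"
  shows "grid_flow.path_weight n D a x y \<le> fact a * (real n / real D) ^ a"
  using y
proof (induction a arbitrary: y)
  case (Suc a)
  let ?c = "real n / real D" and ?w = "grid_flow.path_weight n D a x"
  define Z where "Z = {z \<in> grid n D. ?w z * flow n D z y \<noteq> 0}"
  define I where "I = {i \<in> {1..D}. x i < y i}"
  have Z_sub: "Z \<subseteq> (\<lambda>i. y(i := y i - 1)) ` I"
  proof
    fix z assume "z \<in> Z"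
    then have z: "z \<in> grid n D" "?w z \<noteq> 0" "flow n D z y \<noteq> 0" by (auto simp: Z_def)
    obtain i where i: "i \<in> {1..D}" "y = z(i := Suc (z i))"
      using flow_support[OF z(1) Suc.prems z(3)] .
    have "x i \<le> z i" using path_weight_grid_le[OF x z(1,2)] i(1) by (simp add: grid_le_def)
    then have "i \<in> I" "z = y(i := y i - 1)" using i by (auto simp: I_def)
    then show "z \<in> (\<lambda>i. y(i := y i - 1)) ` I" by blast
  qed
  have "card Z \<le> Suc a"
  proof (cases "Z = {}")
    case False
    then obtain z where z: "z \<in> grid n D" "?w z \<noteq> 0" "flow n D z y \<noteq> 0" by (auto simp: Z_def)
    have r: "rank D y = rank D x + Suc a"
      using grid_flow.path_weight_rank[OF x z(1,2)] flow_rank[OF z(1) Suc.prems z(3)] by simp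
    obtain j where "y = z(j := Suc (z j))" using flow_support[OF z(1) Suc.prems z(3)] .
    then have xy: "x i \<le> y i" if "i \<in> {1..D}" for i
      using path_weight_grid_le[OF x z(1,2)] that by (auto simp: grid_le_def le_Suc_eq)
    have "card Z \<le> card I"
      using surj_card_le[OF _ Z_sub] by (simp add: I_def)
    also have "\<dots> = (\<Sum>i\<in>I. 1)" by simp
    also have "\<dots> \<le> (\<Sum>i\<in>{1..D}. y i - x i)"
      by (rule order_trans[OF sum_mono sum_mono2]) (auto simp: I_def)
    also have "\<dots> = rank D y - rank D x"
      unfolding rank_def using xy by (rule sum_subtractf_nat)
    finally show ?thesis using r by simp
  qed simp
  have "grid_flow.path_weight n D (Suc a) x y = (\<Sum>z\<in>Z. ?w z * flow n D z y)"
    unfolding grid_flow.path_weight.simps Z_def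
    by (rule sum.mono_neutral_right) (auto simp: finite_grid)
  also have "\<dots> \<le> (\<Sum>z\<in>Z. (fact a * ?c ^ a) * ?c)"
  proof (rule sum_mono)
    fix z assume "z \<in> Z"
    then have z: "z \<in> grid n D" by (simp add: Z_def)
    show "?w z * flow n D z y \<le> (fact a * ?c ^ a) * ?c"
      by (rule mult_mono[OF Suc.IH[OF z] flow_le[OF Suc.prems z]]) (simp_all add: flow_nonneg)
  qed
  also have "\<dots> = real (card Z) * (fact a * ?c ^ Suc a)" by simp
  also have "\<dots> \<le> real (Suc a) * (fact a * ?c ^ Suc a)"
    using \<open>card Z \<le> Suc a\<close> by (intro mult_right_mono) auto
  also have "\<dots> = fact (Suc a) * ?c ^ Suc a" by (simp add: algebra_simps)
  finally show ?case .
qed simp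

text \<open>
  Further steps do not increase the bound: the weight of the longer paths to \<open>y\<close> is a combination of
  those to its lower neighbours, with coefficients of sum at most \<open>1\<close>.
\<close>

lemma path_weight_le:
  assumes x: "x \<in> grid n D" and y: "y \<in> grid n D" and "a \<le> d"
  shows "grid_flow.path_weight n D d x y \<le> fact a * (real n / real D) ^ a"
  using \<open>a \<le> d\<close> y
proof (induction d arbitrary: y rule: dec_induct)
  case base
  then show ?case using path_weight_exact_le[OF x] by simp
next
  case (step d)
  let ?B = "fact a * (real n / real D) ^ a :: real"
  have "grid_flow.path_weight n D (Suc d) x y
      \<le> (\<Sum>z\<in>grid n D. ?B * flow n D z y)"
    unfolding grid_flow.path_weight.simps
    by (intro sum_mono mult_right_mono flow_nonneg step.IH)
  also have "\<dots> = ?B * (\<Sum>z\<in>grid n D. flow n D z y)" by (simp only: sum_distrib_left)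
  also have "\<dots> \<le> ?B * 1"
    by (intro mult_left_mono flow_in_le_1 step.prems) simp
  finally show ?case by simp
qed

lemma path_weights_between_le:
  assumes x: "x \<in> grid n D" and y: "y \<in> grid n D" and a: "a \<ge> 1"
  shows "(\<Sum>d\<in>{a..rank D y}. grid_flow.path_weight n D d x y)
     \<le> (if grid_less D x y then fact a * (real n / real D) ^ a else 0)"
proof (cases "\<exists>d\<in>{a..rank D y}. grid_flow.path_weight n D d x y \<noteq> 0")
  case True
  then obtain d where d: "d \<in> {a..rank D y}" "grid_flow.path_weight n D d x y \<noteq> 0" by blast
  have r: "rank D y = rank D x + d" using grid_flow.path_weight_rank[OF x y d(2)] .
  have "(\<Sum>d\<in>{a..rank D y}. grid_flow.path_weight n D d x y)
      = (\<Sum>d\<in>{d}. grid_flow.path_weight n D d x y)"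
    using d(1) r grid_flow.path_weight_rank[OF x y]
    by (intro sum.mono_neutral_right) auto
  moreover have "grid_less D x y"
    using path_weight_grid_le[OF x y d(2)] r d(1) a by (auto simp: grid_less_def)
  ultimately show ?thesis using path_weight_le[OF x y, of a d] d(1) by simp
qed (auto simp: sum.neutral)

theorem theorem2p1:
  fixes n D a b :: nat and X :: "(nat \<Rightarrow> nat) set"
  assumes "n \<ge> 2" and "D \<ge> 1" and "a \<ge> 1" and "b \<ge> 1"
    and "X \<subseteq> grid n D"
    and "real (card X) \<ge>
      real a * (1 + 3 * real n / real D) * real (middle_layer_size n D) + real b"
  shows "real (card (comparable_pairs D X)) \<ge> real b / (fact a * real n ^ a) * real D ^ a"
proof -
  let ?N = "real (middle_layer_size n D)" and ?B = "fact a * (real n / real D) ^ a :: real"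
  have fin: "finite X" using assms(5) finite_grid by (rule finite_subset)
  have sub: "comparable_pairs D X \<subseteq> X \<times> X" by (auto simp: comparable_pairs_def)
  have "real a * ?N + real b \<le> real a * (1 + 3 * real n / real D) * ?N + real b"
    by (intro add_right_mono mult_right_mono) (simp_all add: mult_le_cancel_left1)
  then have "real b \<le> real (card X) - real a * ?N" using assms(6) by linarith
  also have "\<dots> \<le> real (card X) - real a * grid_flow.sources n D"
    using sources_le_middle_layer_size[of n D] assms(1) by (intro diff_left_mono mult_left_mono) auto
  also have "\<dots> \<le> (\<Sum>y\<in>X. \<Sum>x\<in>X. \<Sum>d\<in>{a..rank D y}. grid_flow.path_weight n D d x y)"
    by (rule grid_flow.card_minus_sources_le_path_weights[OF assms(5)])
  also have "\<dots> \<le> (\<Sum>y\<in>X. \<Sum>x\<in>X. if grid_less D x y then ?B else 0)"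
    using assms(3,5) by (intro sum_mono path_weights_between_le) auto
  also have "\<dots> = (\<Sum>(x, y)\<in>X \<times> X. if grid_less D x y then ?B else 0)"
    by (subst sum.swap) (rule sum.cartesian_product)
  also have "\<dots> = (\<Sum>p\<in>comparable_pairs D X. ?B)"
    using fin by (intro sum.mono_neutral_cong_right sub) (auto simp: comparable_pairs_def split: if_splits)
  also have "\<dots> = real (card (comparable_pairs D X)) * ?B" by simp
  finally have "real b \<le> real (card (comparable_pairs D X)) * ?B" .
  moreover have "?B > 0" using assms(1,2) by simp
  ultimately have "real b / ?B \<le> real (card (comparable_pairs D X))"
    by (simp add: pos_divide_le_eq)
  moreover have "real b / ?B = real b / (fact a * real n ^ a) * real D ^ a"
    by (simp add: power_divide)
  ultimately show ?thesis by simp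
qed

end
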